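(* Assume the continuum hypothesis (CH), $2^{\omega}=\omega_1$. Let $G$ be a sequentially compact CHART group (compact Hausdorff admissible right topological group). Then $G$ is metrizable.
   Context: A group $G$ with a topology is called right topological if all right shifts $\rho_h: G\to G$, $g\mapsto gh$ ($h\in G$), are continuous. The topological center $\Lambda(G)$ is the set of all $g\in G$ for which the left shift $\lambda_g: G\to G$, $h\mapsto gh$, is continuous. A right topological group $G$ is admissible if $\Lambda(G)$ is dense in $G$. A CHART group is a compact Hausdorff admissible right topological group. A space is sequentially compact if every sequence in it has a convergent subsequence. *)

theory Defs
  imports "HOL-Analysis.Analysis" "HOL-Algebra.Group"
begin

unbundle cardinal_syntax

definition continuum_hypothesis :: bool where
  "continuum_hypothesis \<longleftrightarrow> ctwo ^c natLeq =o cardSuc natLeq"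

unbundle no cardinal_syntax

definition sequentially_compact_space :: "'a topology \<Rightarrow> bool" where
  "sequentially_compact_space T \<longleftrightarrow>
    (\<forall>s :: nat \<Rightarrow> 'a. range s \<subseteq> topspace T \<longrightarrow>
      (\<exists>l r. strict_mono (r :: nat \<Rightarrow> nat) \<and> limitin T (s \<circ> r) l sequentially))"

locale right_topological_group = group G for G (structure) and T :: "'a topology" +
  assumes topspace_eq_carrier: "topspace T = carrier G"
    and continuous_right_shift: "h \<in> carrier G \<Longrightarrow> continuous_map T T (\<lambda>g. g \<otimes> h)"

definition topological_center :: "('a, 'b) monoid_scheme \<Rightarrow> 'a topology \<Rightarrow> 'a set" where
  "topological_center G T =
    {g \<in> carrier G. continuous_map T T (\<lambda>h. g \<otimes>\<^bsub>G\<^esub> h)}"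

locale admissible_right_topological_group = right_topological_group +
  assumes topological_center_dense: "T closure_of (topological_center G T) = topspace T"

locale CHART_group = admissible_right_topological_group +
  assumes compact: "compact_space T"
    and Hausdorff: "Hausdorff_space T"

end

theory Submission
  imports Defs "HOL-Library.Countable_Set_Type"
begin

text \<open>
  The argument has two independent halves, joined by the notion of a countable local \<open>\<pi>\<close>-base at
  a point \<open>p\<close>: countably many nonempty open sets, which need not contain \<open>p\<close>, such that every
  neighbourhood of \<open>p\<close> includes one of them.

  Topology: under CH, a nonempty sequentially compact compact Hausdorff space has a countable local
  \<open>\<pi>\<close>-base at some point (\<open>sequentially_compact_imp_countable_local_pi_base\<close>). Suppose not.
  CH enumerates the subsets of the naturals in a well-order all of whose initial segments are
  countable. Along it, closed sets are chosen, one for each \<open>n\<close> and each index, in such a way that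
  for every \<open>n\<close> the sets chosen so far always have a common point, and that for the index \<open>R\<close>,
  if infinite, some continuous function is small on the \<open>n\<close>-th set for infinitely many \<open>n\<close> in \<open>R\<close>
  and large on it for infinitely many others. If \<open>x n\<close> is a common point of all the \<open>n\<close>-th sets, the
  sequence \<open>x\<close> has no convergent subsequence. A step of the recursion is possible because fewer than
  continuum many means countably many: the intersections so far have countable neighbourhood bases,
  and these do not form a local \<open>\<pi>\<close>-base at a limit of points taken from them
  (\<open>separate_along_infinite_set\<close>).

  Groups: a CHART group with a countable local \<open>\<pi>\<close>-base at one point is metrizable
  (\<open>countable_local_pi_base_imp_metrizable\<close>). Right translations carry the
  local \<open>\<pi>\<close>-base around, and by compactness finitely many elements of the topological center meet
  every right translate of a given nonempty open set. Together these give a countable dense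
  subset \<open>D\<close> of the topological center and a countable \<open>\<pi>\<close>-base of the whole space. Choose a bump
  function \<open>\<phi> V\<close> inside each member \<open>V\<close> of this \<open>\<pi>\<close>-base. An element \<open>h\<close> whose right translation
  fixes all these bump functions is trivial: the open set of all \<open>x\<close> near the unit with
  \<open>x \<otimes> h\<close> near \<open>h\<close> includes some \<open>V\<close>, and the invariance of \<open>\<phi> V\<close> forces \<open>v \<otimes> h\<close> back into \<open>V\<close>,
  hence near the unit, for a suitable \<open>v\<close> in \<open>V\<close>. Consequently the countably many continuous functions
  \<open>y \<mapsto> \<phi> V (d \<otimes> y)\<close> with \<open>d\<close> in \<open>D\<close> separate points.
\<close>

section \<open>The continuum hypothesis as a well-order\<close>

unbundle cardinal_syntax

lemma continuum_hypothesis_imp_countable_underS: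
  assumes continuum_hypothesis
  obtains r :: "nat set rel"
  where "Well_order r" "Field r = UNIV" "\<And>a. countable (underS r a)"
proof
  let ?r = "|UNIV :: nat set set|"
  show "Well_order ?r"
    by (rule card_of_Well_order)
  show "Field ?r = UNIV"
    by (rule Field_card_of)
  fix a :: "nat set"
  have "?r =o ctwo ^c |UNIV :: nat set|"
    using card_of_Pow_Func[of "UNIV :: nat set"] by (simp add: cexp_def ctwo_def Field_card_of)
  also have "ctwo ^c |UNIV :: nat set| =o ctwo ^c natLeq"
    by (intro cexp_cong2 card_of_nat card_of_Card_order natLeq_Card_order Card_order_ctwo)
  also have "ctwo ^c natLeq =o cardSuc natLeq"
    using assms by (simp add: continuum_hypothesis_def)
  finally have "?r =o cardSuc natLeq" .
  moreover have "|underS ?r a| <o ?r"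
    by (rule card_of_underS[OF card_of_Card_order]) (simp only: Field_card_of UNIV_I)
  ultimately have "|underS ?r a| <o cardSuc natLeq"
    by (rule ordLess_ordIso_trans[rotated])
  then have "|underS ?r a| \<le>o natLeq"
    by (rule iffD1[OF cardSuc_ordLeq_ordLess[OF natLeq_Card_order card_of_Card_order]])
  then show "countable (underS ?r a)"
    by (simp add: countable_card_le_natLeq)
qed

unbundle no cardinal_syntax

section \<open>Sequential compactness and local \<pi>-bases\<close>

text \<open>
  In a compact space, a set cut out by countably many inequalities \<open>f i x \<le> 0\<close> has a countable
  neighbourhood base: the sets cut out by finitely many relaxed inequalities. With \<open>W = {}\<close> the
  lemma says that inequalities that are finitely satisfiable have a common solution.
\<close>

lemma compact_space_finitely_many_inequalities:
  fixes f :: "'i \<Rightarrow> 'a \<Rightarrow> real"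
  assumes "compact_space T"
    and cont: "\<And>i. i \<in> I \<Longrightarrow> continuous_map T euclideanreal (f i)"
    and W: "openin T W" and sub: "{x \<in> topspace T. \<forall>i\<in>I. f i x \<le> 0} \<subseteq> W"
  obtains F j where "finite F" "F \<subseteq> I" "{x \<in> topspace T. \<forall>i\<in>F. f i x < 1 / real (Suc j)} \<subseteq> W"
proof -
  define Q where "Q = (\<lambda>(i, j). {x \<in> topspace T. f i x > 1 / real (Suc j)})"
  have cover: "topspace T \<subseteq> \<Union> (insert W (Q ` (I \<times> UNIV)))"
  proof
    fix x assume x: "x \<in> topspace T"
    show "x \<in> \<Union> (insert W (Q ` (I \<times> UNIV)))"
    proof (cases "x \<in> W")
      case False
      then obtain i where i: "i \<in> I" "f i x > 0"
        using sub x by force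
      then obtain j where "1 / real (Suc j) < f i x"
        using reals_Archimedean[of "f i x"] by (auto simp: inverse_eq_divide)
      then have "x \<in> Q (i, j)"
        using x by (simp add: Q_def)
      moreover have "Q (i, j) \<in> insert W (Q ` (I \<times> UNIV))"
        using i by simp
      ultimately show ?thesis
        by (rule UnionI[rotated])
    qed simp
  qed
  have "openin T (Q (i, j))" if "i \<in> I" for i j
    using openin_continuous_map_preimage[OF cont[OF that], of "{1 / real (Suc j)<..}"]
    by (simp add: Q_def)
  then have "\<forall>U \<in> insert W (Q ` (I \<times> UNIV)). openin T U"
    using W by auto
  with cover \<open>compact_space T\<close> obtain \<F> where \<F>: "finite \<F>" "\<F> \<subseteq> insert W (Q ` (I \<times> UNIV))"
    "topspace T \<subseteq> \<Union> \<F>"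
    unfolding compact_space_alt by meson
  have "finite (\<F> - {W})" "\<F> - {W} \<subseteq> Q ` (I \<times> UNIV)"
    using \<F> by auto
  then obtain A where A: "A \<subseteq> I \<times> UNIV" "finite A" "\<F> - {W} = Q ` A"
    using finite_subset_image by metis
  define k where "k = Max (insert 0 (snd ` A))"
  show ?thesis
  proof
    show "finite (fst ` A)" "fst ` A \<subseteq> I"
      using A by auto
    show "{x \<in> topspace T. \<forall>i\<in>fst ` A. f i x < 1 / real (Suc k)} \<subseteq> W"
    proof clarify
      fix x assume x: "x \<in> topspace T" "\<forall>i\<in>fst ` A. f i x < 1 / real (Suc k)"
      have "x \<notin> Q (i, j)" if "(i, j) \<in> A" for i j
      proof -
        have "j \<le> k"
          unfolding k_def using A(2) that by (intro Max_ge) (auto simp: rev_image_eqI)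
        then have "1 / real (Suc k) \<le> 1 / real (Suc j)"
          by (simp add: frac_le)
        moreover have "f i x < 1 / real (Suc k)"
          using x that by force
        ultimately show ?thesis
          by (simp add: Q_def)
      qed
      then have "x \<notin> \<Union> (Q ` A)"
        by auto
      moreover have "x \<in> \<Union> \<F>"
        using x \<F>(3) by blast
      ultimately show "x \<in> W"
        by (metis A(3) DiffI UnionE UnionI singletonD)
    qed
  qed
qed

definition local_pi_base :: "'a topology \<Rightarrow> 'a \<Rightarrow> 'a set set \<Rightarrow> bool" where
  "local_pi_base T p \<U> \<longleftrightarrow>
    (\<forall>U\<in>\<U>. openin T U \<and> U \<noteq> {}) \<and> (\<forall>W. openin T W \<and> p \<in> W \<longrightarrow> (\<exists>U\<in>\<U>. U \<subseteq> W))"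

text \<open>
  One step of the recursion. The functions \<open>f i n\<close> describe, for each \<open>n\<close>, the closed set \<open>K n\<close> of
  points at which all of them are nonpositive. Points \<open>p n\<close> in \<open>K n\<close> accumulate, along a subsequence
  inside \<open>R\<close>, at some \<open>q\<close>. The basic neighbourhoods of all the \<open>K n\<close> are countably many nonempty open
  sets, by assumption no local \<open>\<pi>\<close>-base at \<open>q\<close>. So some neighbourhood \<open>W\<close> of \<open>q\<close> includes none of them, so no
  \<open>K n\<close> lies inside \<open>W\<close>. Thus infinitely many \<open>K n\<close> have points close to \<open>q\<close>, whereas all of them have
  points outside \<open>W\<close>, and one is free to shrink each \<open>K n\<close> in one direction or the other.
\<close>

lemma separate_along_infinite_set:
  fixes f :: "'i \<Rightarrow> nat \<Rightarrow> 'a \<Rightarrow> real"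
  assumes comp: "compact_space T" and haus: "Hausdorff_space T"
    and seq: "sequentially_compact_space T"
    and no_base: "\<And>p \<U>. p \<in> topspace T \<Longrightarrow> countable \<U> \<Longrightarrow> \<not> local_pi_base T p \<U>"
    and "countable I" and cont: "\<And>i n. i \<in> I \<Longrightarrow> continuous_map T euclideanreal (f i n)"
    and nonempty: "\<And>n. \<exists>x\<in>topspace T. \<forall>i\<in>I. f i n x \<le> 0"
    and "infinite R"
  obtains g :: "nat \<Rightarrow> 'a \<Rightarrow> real" and h :: "'a \<Rightarrow> real"
  where "\<And>n. continuous_map T euclideanreal (g n)" "continuous_map T euclideanreal h"
    "\<And>n. \<exists>x\<in>topspace T. (\<forall>i\<in>I. f i n x \<le> 0) \<and> g n x \<le> 0"
    "infinite {n \<in> R. \<forall>x. g n x \<le> 0 \<longrightarrow> h x \<le> 1/3}"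
    "infinite {n \<in> R. \<forall>x. g n x \<le> 0 \<longrightarrow> h x \<ge> 2/3}"
proof -
  obtain p where p: "\<And>n. p n \<in> topspace T" "\<And>n i. i \<in> I \<Longrightarrow> f i n (p n) \<le> 0"
    using nonempty by metis
  have "range (p \<circ> enumerate R) \<subseteq> topspace T"
    using p by auto
  then obtain q r where r: "strict_mono (r :: nat \<Rightarrow> nat)"
    and lim: "limitin T ((p \<circ> enumerate R) \<circ> r) q sequentially"
    using seq unfolding sequentially_compact_space_def by blast
  define s where "s = enumerate R \<circ> r"
  have "strict_mono s"
    unfolding s_def using strict_mono_enumerate[OF \<open>infinite R\<close>] r by (rule strict_mono_o)
  then have s: "inj s" "range s \<subseteq> R"
    using \<open>infinite R\<close> by (auto simp: s_def enumerate_in_set strict_mono_imp_inj_on)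
  define Q where "Q = (\<lambda>(F, n, j). {x \<in> topspace T. \<forall>i\<in>F. f i n x < 1 / real (Suc j)})"
  define \<Q> where "\<Q> = Q ` ({F. finite F \<and> F \<subseteq> I} \<times> (UNIV :: nat set) \<times> (UNIV :: nat set))"
  have "countable \<Q>"
    unfolding \<Q>_def using \<open>countable I\<close> by (auto intro!: countable_Collect_finite_subset countable_SIGMA)
  moreover have "q \<in> topspace T"
    using lim by (simp add: limitin_def)
  ultimately have no_local_base: "\<not> local_pi_base T q \<Q>"
    using no_base by blast
  have "openin T (Q (F, n, j))" if "finite F" "F \<subseteq> I" for F n j
  proof -
    have "openin T {x \<in> topspace T. f i n x \<in> {..<1 / real (Suc j)}}" if "i \<in> F" for i
      using cont that \<open>F \<subseteq> I\<close> by (intro openin_continuous_map_preimage) auto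
    then have "openin T (topspace T \<inter> (\<Inter>i\<in>F. {x \<in> topspace T. f i n x \<in> {..<1 / real (Suc j)}}))"
      using \<open>finite F\<close> by (intro openin_Int_Inter) auto
    also have "\<dots> = Q (F, n, j)"
      by (auto simp: Q_def)
    finally show ?thesis .
  qed
  moreover have "Q (F, n, j) \<noteq> {}" if "F \<subseteq> I" for F n j
  proof -
    have "f i n (p n) < 1 / real (Suc j)" if "i \<in> F" for i
    proof -
      have "f i n (p n) \<le> 0"
        using p(2) that \<open>F \<subseteq> I\<close> by blast
      also have "0 < 1 / real (Suc j)"
        by simp
      finally show ?thesis .
    qed
    then have "p n \<in> Q (F, n, j)"
      using p(1) by (simp add: Q_def)
    then show ?thesis
      by blast
  qed
  ultimately have "\<forall>V\<in>\<Q>. openin T V \<and> V \<noteq> {}"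
    unfolding \<Q>_def by auto
  then obtain W where W: "openin T W" "q \<in> W" "\<And>V. V \<in> \<Q> \<Longrightarrow> \<not> V \<subseteq> W"
    using no_local_base unfolding local_pi_base_def by blast
  have outside: "\<exists>x\<in>topspace T. x \<notin> W \<and> (\<forall>i\<in>I. f i n x \<le> 0)" for n
  proof (rule ccontr)
    assume "\<not> ?thesis"
    then have sub: "{x \<in> topspace T. \<forall>i\<in>I. f i n x \<le> 0} \<subseteq> W"
      by blast
    obtain F j where F: "finite F" "F \<subseteq> I"
      "{x \<in> topspace T. \<forall>i\<in>F. f i n x < 1 / real (Suc j)} \<subseteq> W"
      by (rule compact_space_finitely_many_inequalities
          [of T I "\<lambda>i. f i n", OF comp cont W(1) sub])
    then have "Q (F, n, j) \<subseteq> W"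
      by (simp add: Q_def)
    moreover have "Q (F, n, j) \<in> \<Q>"
      unfolding \<Q>_def using F(1,2) by blast
    ultimately show False
      using W(3) by blast
  qed
  have "completely_regular_space T"
    using comp haus compact_Hausdorff_or_regular_imp_normal_space normal_imp_completely_regular_space
    by blast
  then obtain h :: "'a \<Rightarrow> real" where h: "continuous_map T euclideanreal h" "h q = 0"
    "h ` (topspace T - W) \<subseteq> {1}"
    using W(1,2) unfolding completely_regular_space_alt' by meson
  let ?L = "{x \<in> topspace T. h x \<in> {..<1/3}}"
  have "openin T ?L"
    by (rule openin_continuous_map_preimage[OF h(1)]) simp
  moreover have "q \<in> ?L"
    using h(2) \<open>q \<in> topspace T\<close> by simp
  ultimately have "eventually (\<lambda>k. ((p \<circ> enumerate R) \<circ> r) k \<in> ?L) sequentially"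
    using lim unfolding limitin_def by blast
  then obtain N where "\<And>k. k \<ge> N \<Longrightarrow> ((p \<circ> enumerate R) \<circ> r) k \<in> ?L"
    unfolding eventually_sequentially by blast
  then have N: "h (p (s k)) < 1/3" if "k \<ge> N" for k
    using that by (simp add: s_def)
  \<comment> \<open>The even terms of the subsequence are shrunk towards \<open>q\<close>; all other indices, among them the
    odd terms, are shrunk away from \<open>W\<close>.\<close>
  define E where "E = s ` {k. k \<ge> N \<and> even k}"
  define g where "g = (\<lambda>n x. if n \<in> E then h x - 1/3 else 2/3 - h x)"
  have inf: "infinite {k. k \<ge> N \<and> even k}" "infinite {k. k \<ge> N \<and> odd k}"
  proof -
    have "\<exists>n>m. n \<ge> N \<and> even n" for m
      by (intro exI[of _ "2 * (m + N + 1)"]) auto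
    moreover have "\<exists>n>m. n \<ge> N \<and> odd n" for m
      by (intro exI[of _ "2 * (m + N) + 1"]) auto
    ultimately show "infinite {k. k \<ge> N \<and> even k}" "infinite {k. k \<ge> N \<and> odd k}"
      by (simp_all add: infinite_nat_iff_unbounded)
  qed
  show ?thesis
  proof
    show "continuous_map T euclideanreal (g n)" for n
      using h(1) by (cases "n \<in> E") (auto simp: g_def intro!: continuous_map_diff)
    show "continuous_map T euclideanreal h"
      by (fact h(1))
    show "\<exists>x\<in>topspace T. (\<forall>i\<in>I. f i n x \<le> 0) \<and> g n x \<le> 0" for n
    proof (cases "n \<in> E")
      case True
      then obtain k where "n = s k" "k \<ge> N"
        unfolding E_def by blast
      then have "g n (p n) \<le> 0"
        using N[of k] True by (simp add: g_def)
      then show ?thesis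
        using p by blast
    next
      case False
      from outside[of n] obtain x where x: "x \<in> topspace T" "x \<notin> W" "\<forall>i\<in>I. f i n x \<le> 0"
        by blast
      then have "h x = 1"
        using h(3) by blast
      then show ?thesis
        using x False by (auto simp: g_def)
    qed
    have "infinite E"
      unfolding E_def using inf(1) s(1) by (simp add: finite_image_iff inj_on_subset)
    moreover have "E \<subseteq> {n \<in> R. \<forall>x. g n x \<le> 0 \<longrightarrow> h x \<le> 1/3}"
      using s(2) by (auto simp: E_def g_def)
    ultimately show "infinite {n \<in> R. \<forall>x. g n x \<le> 0 \<longrightarrow> h x \<le> 1/3}"
      using finite_subset by blast
    have "infinite (s ` {k. k \<ge> N \<and> odd k})"
      using inf(2) s(1) by (simp add: finite_image_iff inj_on_subset)
    moreover have "s ` {k. k \<ge> N \<and> odd k} \<subseteq> {n \<in> R. \<forall>x. g n x \<le> 0 \<longrightarrow> h x \<ge> 2/3}"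
      using s by (auto simp: E_def g_def dest: injD)
    ultimately show "infinite {n \<in> R. \<forall>x. g n x \<le> 0 \<longrightarrow> h x \<ge> 2/3}"
      using finite_subset by blast
  qed
qed

lemma sequentially_compact_imp_countable_local_pi_base:
  assumes CH: continuum_hypothesis
    and comp: "compact_space T" and haus: "Hausdorff_space T"
    and seq: "sequentially_compact_space T" and "topspace T \<noteq> {}"
  obtains p \<U> where "p \<in> topspace T" "countable \<U>" "local_pi_base T p \<U>"
proof (rule ccontr)
  assume "\<not> thesis"
  then have no_base: "\<And>p \<U>. p \<in> topspace T \<Longrightarrow> countable \<U> \<Longrightarrow> \<not> local_pi_base T p \<U>"
    using that by blast
  obtain r :: "nat set rel" where r: "Well_order r" "Field r = UNIV" "\<And>a. countable (underS r a)"
    using continuum_hypothesis_imp_countable_underS[OF CH] by blast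
  have wf: "wf (r - Id)" and lin: "linear_order_on UNIV r"
    using r(1,2) by (simp_all add: well_order_on_def)
  \<comment> \<open>\<open>P f R g\<close> says that \<open>g\<close> is an admissible choice at stage \<open>R\<close>, given the choices \<open>f\<close> at the
    earlier stages.\<close>
  define P :: "(nat set \<Rightarrow> nat \<Rightarrow> 'a \<Rightarrow> real) \<Rightarrow> nat set \<Rightarrow> (nat \<Rightarrow> 'a \<Rightarrow> real) \<Rightarrow> bool"
    where "P = (\<lambda>f R g. (\<forall>n. continuous_map T euclideanreal (g n)) \<and>
      (\<forall>n. \<exists>x\<in>topspace T. (\<forall>i\<in>underS r R. f i n x \<le> 0) \<and> g n x \<le> 0) \<and>
      (infinite R \<longrightarrow> (\<exists>h. continuous_map T euclideanreal h \<and>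
        infinite {n \<in> R. \<forall>x. g n x \<le> 0 \<longrightarrow> h x \<le> 1/3} \<and>
        infinite {n \<in> R. \<forall>x. g n x \<le> 0 \<longrightarrow> h x \<ge> 2/3})))"
  \<comment> \<open>The last of finitely many admissible stages already provides a common point for all of them,
    and compactness passes from finitely many stages to all.\<close>
  have common: "\<exists>x\<in>topspace T. \<forall>i\<in>S. f i n x \<le> 0" if f: "\<And>i. i \<in> S \<Longrightarrow> P f i (f i)" for S f n
  proof (rule ccontr)
    assume "\<not> ?thesis"
    then have empty: "{x \<in> topspace T. \<forall>i\<in>S. f i n x \<le> 0} \<subseteq> {}"
      by blast
    have cont: "continuous_map T euclideanreal (f i n)" if "i \<in> S" for i
      using f[OF that] by (simp add: P_def)
    obtain F j where F: "finite F" "F \<subseteq> S"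
      "{x \<in> topspace T. \<forall>i\<in>F. f i n x < 1 / real (Suc j)} \<subseteq> {}"
      by (rule compact_space_finitely_many_inequalities
          [of T S "\<lambda>i. f i n", OF comp cont openin_empty empty])
    have "\<exists>x\<in>topspace T. \<forall>i\<in>F. f i n x \<le> 0"
    proof (cases "F = {}")
      case False
      obtain m where m: "m \<in> F" "\<And>i. i \<in> F \<Longrightarrow> (i, m) \<in> r"
      proof -
        have "\<exists>m\<in>F. \<forall>i\<in>F. (i, m) \<in> r"
          using F(1) False
        proof (induction F rule: finite_ne_induct)
          case (singleton x)
          then show ?case
            using lin by (auto simp: order_on_defs refl_on_def)
        next
          case (insert x F)
          then obtain m where m: "m \<in> F" "\<forall>i\<in>F. (i, m) \<in> r"
            by blast
          have refl: "(x, x) \<in> r" and trans: "trans r"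
            using lin by (auto simp: order_on_defs refl_on_def)
          show ?case
          proof (cases "(x, m) \<in> r")
            case False
            then have "(m, x) \<in> r"
              using lin refl by (metis UNIV_I linear_order_on_def total_on_def)
            then have "\<forall>i\<in>insert x F. (i, x) \<in> r"
              using m refl trans by (auto dest: transD)
            then show ?thesis
              by blast
          qed (use m in auto)
        qed
        then show ?thesis
          using that by blast
      qed
      have "P f m (f m)"
        using f F(2) m(1) by blast
      then obtain x where x: "x \<in> topspace T" "\<forall>i\<in>underS r m. f i n x \<le> 0" "f m n x \<le> 0"
        unfolding P_def by blast
      have "f i n x \<le> 0" if "i \<in> F" for i
        using x m(2)[OF that] by (cases "i = m") (auto simp: underS_def)
      then show ?thesis
        using x by blast
    qed (use \<open>topspace T \<noteq> {}\<close> in blast)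
    then obtain x where "x \<in> topspace T" "\<forall>i\<in>F. f i n x \<le> 0"
      by blast
    then have "x \<in> {x \<in> topspace T. \<forall>i\<in>F. f i n x < 1 / real (Suc j)}"
      by (fastforce intro: le_less_trans)
    then show False
      using F(3) by blast
  qed
  have "\<exists>f. \<forall>R. P f R (f R)"
  proof (rule dependent_wf_choice[OF wf])
    fix f g :: "nat set \<Rightarrow> nat \<Rightarrow> 'a \<Rightarrow> real" and R k
    assume "\<And>Q. (Q, R) \<in> r - Id \<Longrightarrow> f Q = g Q"
    then have "f i = g i" if "i \<in> underS r R" for i
      using that by (simp add: underS_def)
    then show "P f R k = P g R k"
      by (simp add: P_def)
  next
    fix R f assume "\<And>Q. (Q, R) \<in> r - Id \<Longrightarrow> P f Q (f Q)"
    then have f: "P f i (f i)" if "i \<in> underS r R" for i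
      using that by (simp add: underS_def)
    have cont: "continuous_map T euclideanreal (f i n)" if "i \<in> underS r R" for i n
      using f[OF that] by (simp add: P_def)
    have nonempty: "\<exists>x\<in>topspace T. \<forall>i\<in>underS r R. f i n x \<le> 0" for n
      using f by (rule common)
    show "\<exists>g. P f R g"
    proof (cases "infinite R")
      case True
      show ?thesis
      proof (rule separate_along_infinite_set
            [where f = f, OF comp haus seq no_base r(3) cont nonempty True])
        fix g :: "nat \<Rightarrow> 'a \<Rightarrow> real" and h assume
          "\<And>n. continuous_map T euclideanreal (g n)" "continuous_map T euclideanreal h"
          "\<And>n. \<exists>x\<in>topspace T. (\<forall>i\<in>underS r R. f i n x \<le> 0) \<and> g n x \<le> 0"
          "infinite {n \<in> R. \<forall>x. g n x \<le> 0 \<longrightarrow> h x \<le> 1/3}"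
          "infinite {n \<in> R. \<forall>x. g n x \<le> 0 \<longrightarrow> h x \<ge> 2/3}"
        then have "P f R g"
          unfolding P_def by blast
        then show ?thesis
          by blast
      qed
    next
      case False
      have "P f R (\<lambda>_ _. 0)"
        using False nonempty by (simp add: P_def)
      then show ?thesis
        by blast
    qed
  qed
  then obtain f where f: "\<And>R. P f R (f R)"
    by blast
  have "\<exists>x\<in>topspace T. \<forall>R. f R n x \<le> 0" for n
    using common[of UNIV f n] f by simp
  then obtain x where x: "\<And>n. x n \<in> topspace T" "\<And>n R. f R n (x n) \<le> 0"
    by metis
  then have "range x \<subseteq> topspace T"
    by auto
  then obtain l u where u: "strict_mono (u :: nat \<Rightarrow> nat)" and lim: "limitin T (x \<circ> u) l sequentially"
    using seq unfolding sequentially_compact_space_def by blast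
  \<comment> \<open>The stage indexed by the range of the subsequence \<open>u\<close> prevents its convergence.\<close>
  have "infinite (range u)"
    using u by (simp add: range_inj_infinite strict_mono_imp_inj_on)
  with f[of "range u"] obtain h where h: "continuous_map T euclideanreal h"
    and low: "infinite {n \<in> range u. \<forall>y. f (range u) n y \<le> 0 \<longrightarrow> h y \<le> 1/3}"
    and high: "infinite {n \<in> range u. \<forall>y. f (range u) n y \<le> 0 \<longrightarrow> h y \<ge> 2/3}"
    unfolding P_def by blast
  have infinitely_often: "\<exists>k\<ge>N. Q (u k)" if "infinite {n \<in> range u. Q n}" for N Q
  proof (rule ccontr)
    assume "\<not> ?thesis"
    then have "{n \<in> range u. Q n} \<subseteq> u ` {..<N}"
      using not_le by auto
    then show False
      using that finite_subset by blast
  qed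
  have "limitin euclideanreal (h \<circ> (x \<circ> u)) (h l) sequentially"
    using h lim by (rule continuous_map_limit)
  then have "(\<lambda>k. h (x (u k))) \<longlonglongrightarrow> h l"
    by (simp add: o_def)
  then obtain N where N: "\<And>k. k \<ge> N \<Longrightarrow> \<bar>h (x (u k)) - h l\<bar> < 1/6"
    unfolding LIMSEQ_def dist_real_def by (metis zero_less_divide_1_iff zero_less_numeral)
  from infinitely_often[OF low, of N] obtain k where "k \<ge> N" "h (x (u k)) \<le> 1/3"
    using x(2) by blast
  moreover from infinitely_often[OF high, of N] obtain k' where "k' \<ge> N" "h (x (u k')) \<ge> 2/3"
    using x(2) by blast
  ultimately show False
    using N[of k] N[of k'] by linarith
qed

section \<open>Countable local \<pi>-bases in CHART groups\<close>

lemma compact_space_countable_separating_imp_metrizable: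
  fixes f :: "'i \<Rightarrow> 'a \<Rightarrow> real"
  assumes "compact_space T" "countable I"
    and cont: "\<And>i. i \<in> I \<Longrightarrow> continuous_map T euclideanreal (f i)"
    and sep: "\<And>x y. x \<in> topspace T \<Longrightarrow> y \<in> topspace T \<Longrightarrow> (\<And>i. i \<in> I \<Longrightarrow> f i x = f i y) \<Longrightarrow> x = y"
  shows "metrizable_space T"
proof -
  define F where "F = (\<lambda>x. \<lambda>i\<in>I. f i x)"
  let ?Y = "product_topology (\<lambda>_. euclideanreal) I"
  have "embedding_map T ?Y F"
  proof (rule continuous_imp_embedding_map)
    show "continuous_map T ?Y F"
      using cont by (auto simp: continuous_map_componentwise F_def)
    show "Hausdorff_space ?Y"
      by (simp add: Hausdorff_space_product_topology)
    show "inj_on F (topspace T)"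
      by (intro inj_onI sep) (auto simp: F_def dest: fun_cong split: if_splits)
  qed fact
  then have "T homeomorphic_space subtopology ?Y (F ` topspace T)"
    by (metis embedding_map_def homeomorphic_map_imp_homeomorphic_space)
  moreover have "metrizable_space ?Y"
    using \<open>countable I\<close> by (simp add: metrizable_space_product_topology metrizable_space_euclidean)
  ultimately show ?thesis
    using homeomorphic_metrizable_space metrizable_space_subtopology by blast
qed

definition pi_base :: "'a topology \<Rightarrow> 'a set set \<Rightarrow> bool" where
  "pi_base T \<V> \<longleftrightarrow>
    (\<forall>V\<in>\<V>. openin T V \<and> V \<noteq> {}) \<and> (\<forall>W. openin T W \<and> W \<noteq> {} \<longrightarrow> (\<exists>V\<in>\<V>. V \<subseteq> W))"

context right_topological_group
begin

lemma openin_right_translate_preimage: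
  assumes "openin T U" "h \<in> carrier G"
  shows "openin T {x \<in> carrier G. x \<otimes> h \<in> U}"
  using openin_continuous_map_preimage[OF continuous_right_shift[OF assms(2)] assms(1)]
  by (simp add: topspace_eq_carrier)

lemma openin_in_carrier: "openin T U \<Longrightarrow> x \<in> U \<Longrightarrow> x \<in> carrier G"
  using openin_subset topspace_eq_carrier by fastforce

end

context CHART_group
begin

lemma topological_center_meets_open:
  assumes "openin T U" "U \<noteq> {}"
  shows "\<exists>c \<in> topological_center G T. c \<in> U"
proof -
  obtain x where "x \<in> U"
    using assms by blast
  moreover then have "x \<in> T closure_of topological_center G T"
    using assms openin_subset topological_center_dense by blast
  ultimately show ?thesis
    using assms(1) unfolding in_closure_of by blast
qed

text \<open>
  For \<open>c\<close> in the topological center the set of all \<open>y\<close> with \<open>c \<otimes> y \<in> U\<close> is open, since the left shift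
  by \<open>c\<close> is continuous. These sets cover the group because the topological center is dense and right
  translates of \<open>U\<close> are open.
\<close>

lemma finite_subset_center_meets_right_translates:
  assumes U: "openin T U" "U \<noteq> {}"
  obtains C where "finite C" "C \<subseteq> topological_center G T"
    "\<And>y. y \<in> carrier G \<Longrightarrow> \<exists>c\<in>C. c \<otimes> y \<in> U"
proof -
  define Q where "Q = (\<lambda>c. {y \<in> carrier G. c \<otimes> y \<in> U})"
  have "openin T (Q c)" if "c \<in> topological_center G T" for c
    using that openin_continuous_map_preimage[OF _ U(1), of T "\<lambda>h. c \<otimes> h"]
    by (simp add: Q_def topological_center_def topspace_eq_carrier)
  then have "\<forall>V \<in> Q ` topological_center G T. openin T V"
    by blast
  moreover have "topspace T \<subseteq> \<Union> (Q ` topological_center G T)"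
  proof
    fix y assume "y \<in> topspace T"
    then have y: "y \<in> carrier G"
      by (simp add: topspace_eq_carrier)
    obtain u where u: "u \<in> U" "u \<in> carrier G"
      using U openin_in_carrier by blast
    have "u \<otimes> inv y \<in> {x \<in> carrier G. x \<otimes> y \<in> U}"
      using u y by (simp add: m_assoc)
    then obtain c where "c \<in> topological_center G T" "c \<in> {x \<in> carrier G. x \<otimes> y \<in> U}"
      using topological_center_meets_open[OF openin_right_translate_preimage[OF U(1) y]] by blast
    then show "y \<in> \<Union> (Q ` topological_center G T)"
      using y by (auto simp: Q_def)
  qed
  ultimately obtain \<F> where "finite \<F>" "\<F> \<subseteq> Q ` topological_center G T" "topspace T \<subseteq> \<Union>\<F>"
    using compact unfolding compact_space_alt by meson
  then obtain C where C: "C \<subseteq> topological_center G T" "finite C" "topspace T \<subseteq> \<Union> (Q ` C)"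
    using finite_subset_image by metis
  show ?thesis
  proof
    show "\<exists>c\<in>C. c \<otimes> y \<in> U" if "y \<in> carrier G" for y
      using C(3) that by (auto simp: Q_def topspace_eq_carrier)
  qed (use C in auto)
qed

text \<open>
  Every nonempty open set includes a right translate of some \<open>U\<close> in the local \<open>\<pi>\<close>-base. So the finite
  sets of the previous lemma, taken for all \<open>U\<close>, form a dense set together.
\<close>

lemma countable_local_pi_base_imp_separable:
  assumes p: "p \<in> carrier G" and \<U>: "countable \<U>" "local_pi_base T p \<U>"
  obtains D where "countable D" "D \<subseteq> topological_center G T"
    "\<And>W. openin T W \<Longrightarrow> W \<noteq> {} \<Longrightarrow> D \<inter> W \<noteq> {}"
proof -
  have open_U: "openin T U" "U \<noteq> {}" if "U \<in> \<U>" for U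
    using \<U>(2) that by (auto simp: local_pi_base_def)
  have "\<exists>C. finite C \<and> C \<subseteq> topological_center G T \<and> (\<forall>y \<in> carrier G. \<exists>c\<in>C. c \<otimes> y \<in> U)"
    if "U \<in> \<U>" for U
    using finite_subset_center_meets_right_translates[OF open_U[OF that]] by metis
  then obtain C where C: "\<And>U. U \<in> \<U> \<Longrightarrow> finite (C U) \<and> C U \<subseteq> topological_center G T \<and>
      (\<forall>y \<in> carrier G. \<exists>c\<in>C U. c \<otimes> y \<in> U)"
    by metis
  show ?thesis
  proof
    show "countable (\<Union>U\<in>\<U>. C U)" "(\<Union>U\<in>\<U>. C U) \<subseteq> topological_center G T"
      using C \<U>(1) by (auto intro: countable_finite)
    fix W assume W: "openin T W" "W \<noteq> {}"
    then obtain w where w: "w \<in> W" "w \<in> carrier G"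
      using openin_in_carrier by blast
    \<comment> \<open>Right translation by \<open>?h\<close> takes \<open>p\<close> to \<open>w\<close>.\<close>
    let ?h = "inv p \<otimes> w"
    have h: "?h \<in> carrier G"
      using p w by simp
    have "p \<in> {x \<in> carrier G. x \<otimes> ?h \<in> W}"
      using p w by (simp flip: m_assoc)
    then obtain U where U: "U \<in> \<U>" "U \<subseteq> {x \<in> carrier G. x \<otimes> ?h \<in> W}"
      using \<U>(2) openin_right_translate_preimage[OF W(1) h] unfolding local_pi_base_def by blast
    then obtain c where c: "c \<in> C U" "c \<otimes> inv ?h \<in> U"
      using C h by blast
    then have "c \<in> carrier G"
      using C U(1) by (auto simp: topological_center_def)
    then have "c \<otimes> inv ?h \<otimes> ?h = c"
      using h by (simp add: m_assoc del: inv_mult_group)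
    then have "c \<in> W"
      using c U(2) by (metis (mono_tags, lifting) mem_Collect_eq subsetD)
    then show "(\<Union>U\<in>\<U>. C U) \<inter> W \<noteq> {}"
      using c U(1) by blast
  qed
qed

text \<open>
  Translates of the local \<open>\<pi>\<close>-base to the points of a dense set suffice, as a nonempty open set is a
  neighbourhood of one of these points.
\<close>

lemma countable_local_pi_base_imp_countable_pi_base:
  assumes p: "p \<in> carrier G" and \<U>: "countable \<U>" "local_pi_base T p \<U>"
    and D: "countable D" "D \<subseteq> carrier G" "\<And>W. openin T W \<Longrightarrow> W \<noteq> {} \<Longrightarrow> D \<inter> W \<noteq> {}"
  obtains \<V> where "countable \<V>" "pi_base T \<V>"
proof
  define V where "V = (\<lambda>(U, c). {x \<in> carrier G. x \<otimes> (inv c \<otimes> p) \<in> U})"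
  show "countable (V ` (\<U> \<times> D))"
    using \<U>(1) D(1) by auto
  show "pi_base T (V ` (\<U> \<times> D))"
    unfolding pi_base_def
  proof (intro conjI ballI allI impI)
    fix X assume "X \<in> V ` (\<U> \<times> D)"
    then obtain U c where X: "X = V (U, c)" "U \<in> \<U>" "c \<in> D"
      by auto
    have U: "openin T U" "U \<noteq> {}"
      using \<U>(2) X(2) by (auto simp: local_pi_base_def)
    have c: "inv c \<otimes> p \<in> carrier G"
      using X(3) D(2) p by auto
    show "openin T X"
      using openin_right_translate_preimage[OF U(1) c] by (simp add: X V_def)
    obtain u where u: "u \<in> U" "u \<in> carrier G"
      using U openin_in_carrier by blast
    then have "u \<otimes> inv (inv c \<otimes> p) \<in> X"
      using c by (simp add: X V_def m_assoc del: inv_mult_group)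
    then show "X \<noteq> {}"
      by blast
  next
    fix W assume W: "openin T W \<and> W \<noteq> {}"
    then obtain c where c: "c \<in> D" "c \<in> W" "c \<in> carrier G"
      using D(2,3) by blast
    let ?h = "inv p \<otimes> c"
    have h: "?h \<in> carrier G"
      using p c by simp
    have "p \<in> {x \<in> carrier G. x \<otimes> ?h \<in> W}"
      using p c by (simp flip: m_assoc)
    then obtain U where U: "U \<in> \<U>" "U \<subseteq> {x \<in> carrier G. x \<otimes> ?h \<in> W}"
      using \<U>(2) openin_right_translate_preimage[OF _ h] W unfolding local_pi_base_def by blast
    have "V (U, c) \<subseteq> W"
    proof
      fix x assume "x \<in> V (U, c)"
      then have x: "x \<in> carrier G" "x \<otimes> (inv c \<otimes> p) \<in> U"
        by (auto simp: V_def)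
      then have "x \<otimes> (inv c \<otimes> p) \<otimes> ?h \<in> W"
        using U(2) by blast
      moreover have "x \<otimes> (inv c \<otimes> p) \<otimes> ?h = x"
        using x(1) c p by (metis h inv_closed inv_inv inv_mult_group m_assoc r_inv r_one)
      ultimately show "x \<in> W"
        by simp
    qed
    then show "\<exists>X\<in>V ` (\<U> \<times> D). X \<subseteq> W"
      using U(1) c(1) by blast
  qed
qed

text \<open>
  If \<open>h\<close> is not the unit, the points that lie in a neighbourhood \<open>A\<close> of the unit and are moved by right
  translation with \<open>h\<close> into a neighbourhood \<open>B\<close> of \<open>h\<close> disjoint from \<open>A\<close> form an open set, by continuity
  of the right shift. This set is nonempty, so it includes some \<open>V\<close>. But a point of \<open>V\<close> with
  \<open>\<phi> V = 0\<close> cannot leave \<open>V\<close>, as \<open>\<phi> V\<close> is 1 outside \<open>V\<close>.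
\<close>

lemma right_stabilizer_of_pi_base_bumps_trivial:
  assumes \<V>: "pi_base T \<V>"
    and bump: "\<And>V. V \<in> \<V> \<Longrightarrow> \<exists>v \<in> V. \<phi> V v = (0::real)"
      "\<And>V. V \<in> \<V> \<Longrightarrow> \<phi> V ` (carrier G - V) \<subseteq> {1}"
    and h: "h \<in> carrier G"
    and invariant: "\<And>V x. V \<in> \<V> \<Longrightarrow> x \<in> carrier G \<Longrightarrow> \<phi> V (x \<otimes> h) = \<phi> V x"
  shows "h = \<one>"
proof (rule ccontr)
  assume "h \<noteq> \<one>"
  then obtain A B where AB: "openin T A" "openin T B" "\<one> \<in> A" "h \<in> B" "disjnt A B"
    using Hausdorff h unfolding Hausdorff_space_def by (metis one_closed topspace_eq_carrier)
  let ?W = "A \<inter> {x \<in> carrier G. x \<otimes> h \<in> B}"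
  have "openin T ?W"
    using AB openin_right_translate_preimage[OF _ h] by blast
  moreover have "\<one> \<in> ?W"
    using AB h by simp
  ultimately obtain V where V: "V \<in> \<V>" "V \<subseteq> ?W"
    using \<V> unfolding pi_base_def by blast
  obtain v where v: "v \<in> V" "\<phi> V v = 0"
    using bump(1)[OF V(1)] by blast
  then have vh: "v \<in> carrier G" "v \<otimes> h \<in> B"
    using V(2) by auto
  have "\<phi> V (v \<otimes> h) = 0"
    using invariant[OF V(1) vh(1)] v(2) by simp
  then have "v \<otimes> h \<in> V"
    using bump(2)[OF V(1)] vh(1) h
    by (metis Diff_iff image_subset_iff m_closed singletonD zero_neq_one)
  then have "v \<otimes> h \<in> A"
    using V(2) by blast
  then show False
    using vh(2) AB(5) by (auto simp: disjnt_def)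
qed

theorem countable_local_pi_base_imp_metrizable:
  assumes p: "p \<in> carrier G" and \<U>: "countable \<U>" "local_pi_base T p \<U>"
  shows "metrizable_space T"
proof -
  obtain D where D: "countable D" "D \<subseteq> topological_center G T"
    "\<And>W. openin T W \<Longrightarrow> W \<noteq> {} \<Longrightarrow> D \<inter> W \<noteq> {}"
    using countable_local_pi_base_imp_separable[OF p \<U>] by blast
  have D_carrier: "D \<subseteq> carrier G"
    using D(2) by (auto simp: topological_center_def)
  obtain \<V> where \<V>: "countable \<V>" "pi_base T \<V>"
    using countable_local_pi_base_imp_countable_pi_base[OF p \<U> D(1) D_carrier D(3)] by blast
  have "completely_regular_space T"
    using compact Hausdorff compact_Hausdorff_or_regular_imp_normal_space
      normal_imp_completely_regular_space by blast
  then have "\<exists>f::'a \<Rightarrow> real. continuous_map T euclideanreal f \<and> (\<exists>v\<in>V. f v = 0) \<and>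
      f ` (carrier G - V) \<subseteq> {1}" if "V \<in> \<V>" for V
    using \<V>(2) that unfolding completely_regular_space_alt' pi_base_def topspace_eq_carrier
    by (metis ex_in_conv)
  then obtain \<phi> :: "'a set \<Rightarrow> 'a \<Rightarrow> real" where
    \<phi>: "\<And>V. V \<in> \<V> \<Longrightarrow> continuous_map T euclideanreal (\<phi> V)"
      "\<And>V. V \<in> \<V> \<Longrightarrow> \<exists>v\<in>V. \<phi> V v = 0"
      "\<And>V. V \<in> \<V> \<Longrightarrow> \<phi> V ` (carrier G - V) \<subseteq> {1}"
    by metis
  show ?thesis
  proof (rule compact_space_countable_separating_imp_metrizable)
    show "compact_space T"
      by (fact compact)
    show "countable (\<V> \<times> D)"
      using \<V>(1) D(1) by simp
    let ?f = "\<lambda>i y. \<phi> (fst i) (snd i \<otimes> y)"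
    show "continuous_map T euclideanreal (?f i)" if "i \<in> \<V> \<times> D" for i
    proof -
      have "continuous_map T T (\<lambda>y. snd i \<otimes> y)" "continuous_map T euclideanreal (\<phi> (fst i))"
        using that D(2) \<phi>(1) by (auto simp: topological_center_def)
      then show ?thesis
        by (rule continuous_map_compose[unfolded o_def])
    qed
    fix y z assume "y \<in> topspace T" "z \<in> topspace T"
      and eq: "\<And>i. i \<in> \<V> \<times> D \<Longrightarrow> ?f i y = ?f i z"
    then have yz: "y \<in> carrier G" "z \<in> carrier G"
      by (simp_all add: topspace_eq_carrier)
    \<comment> \<open>Both sides are continuous in \<open>x\<close>, so agreement on the dense set \<open>D\<close> is agreement
      everywhere. Then \<open>inv y \<otimes> z\<close> fixes all bump functions.\<close>
    have all_eq: "\<phi> V (x \<otimes> y) = \<phi> V (x \<otimes> z)" if V: "V \<in> \<V>" and x: "x \<in> carrier G" for V x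
    proof (rule ccontr)
      assume neq: "\<phi> V (x \<otimes> y) \<noteq> \<phi> V (x \<otimes> z)"
      have cont: "continuous_map T euclideanreal (\<lambda>x. \<phi> V (x \<otimes> w))" if "w \<in> carrier G" for w
        using continuous_map_compose[OF continuous_right_shift[OF that] \<phi>(1)[OF V]]
        by (simp add: o_def)
      let ?W = "{x \<in> topspace T. \<phi> V (x \<otimes> y) - \<phi> V (x \<otimes> z) \<in> - {0}}"
      have "openin T ?W"
        by (intro openin_continuous_map_preimage[of T euclideanreal] continuous_map_diff cont yz)
          (auto simp: open_Compl)
      moreover have "x \<in> ?W"
        using neq x by (simp add: topspace_eq_carrier)
      ultimately obtain d where "d \<in> D" "d \<in> ?W"
        using D(3) by blast
      then show False
        using eq[of "(V, d)"] V by simp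
    qed
    have "inv y \<otimes> z = \<one>"
    proof (rule right_stabilizer_of_pi_base_bumps_trivial[OF \<V>(2) \<phi>(2,3)])
      show "inv y \<otimes> z \<in> carrier G"
        using yz by simp
      show "\<phi> V (x \<otimes> (inv y \<otimes> z)) = \<phi> V x" if "V \<in> \<V>" "x \<in> carrier G" for V x
        using all_eq[of V "x \<otimes> inv y"] that yz by (simp add: m_assoc)
    qed
    then show "y = z"
      using yz by (metis inv_closed inv_equality inv_inv)
  qed
qed

end

theorem corollary2:
  fixes G :: "('a, 'b) monoid_scheme" and T :: "'a topology"
  assumes CH: "continuum_hypothesis"
    and chart: "CHART_group G T"
    and seq_compact: "sequentially_compact_space T"
  shows "metrizable_space T"
proof -
  interpret CHART_group G T
    by (fact chart)
  have "topspace T \<noteq> {}"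
    using one_closed topspace_eq_carrier by auto
  then obtain p \<U> where "p \<in> topspace T" "countable \<U>" "local_pi_base T p \<U>"
    using sequentially_compact_imp_countable_local_pi_base[OF CH compact Hausdorff seq_compact]
    by blast
  then show ?thesis
    using countable_local_pi_base_imp_metrizable by (simp add: topspace_eq_carrier)
qed

end
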